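(* There exists a function $h:(0,\infty)\to(0,\infty)$ such that: (i) $h$ is log convex; (ii) $h$ is integrable on $(0,\infty)$; (iii) $\lim_{n\to\infty} h(n)^{1/n}=1$ (limit over positive integers $n$); and (iv) for every real number $r>0$, the function $x\mapsto \dfrac{h(x)^r}{h(rx)}$ is not integrable on $(0,\infty)$.
   Context: A function $h:(0,\infty)\to(0,\infty)$ is log convex if $\log h$ is a convex function on $(0,\infty)$. Integrable on $(0,\infty)$ means belonging to $L^1((0,\infty))$ with respect to Lebesgue measure. *)

theory Defs
  imports "HOL-Analysis.Analysis"
begin

text \<open>A function \<open>h : (0,\<infinity>) \<rightarrow> (0,\<infinity>)\<close> is represented by a total function on the reals that maps
  \<open>{0<..}\<close> into \<open>{0<..}\<close>; its values outside \<open>{0<..}\<close> are irrelevant. The positivity of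
  \<open>h\<close> is not part of the following definition and has to be assumed separately.\<close>

definition log_convex :: "(real \<Rightarrow> real) \<Rightarrow> bool" where
  "log_convex h \<longleftrightarrow> convex_on {0<..} (\<lambda>x. ln (h x))"

end

theory Submission
  imports Defs
begin

text \<open>
  Put \<open>h = exp (- g)\<close> where \<open>g\<close> is the infimum of the lines \<open>\<alpha> k + \<beta> k * x\<close> with
  \<open>\<beta> k = 2 exp (- k)\<close> and \<open>\<alpha>\<close> growing very fast. As an infimum of lines \<open>g\<close> is concave, and the
  slopes \<open>\<beta> k \<rightarrow> 0\<close> force \<open>g n / n \<rightarrow> 0\<close>. Each line lies above \<open>2 ln x\<close>, so
  \<open>h x \<le> min 1 (1 / x\<^sup>2)\<close> is integrable. The \<open>k\<close>-th line realises the infimum on an interval of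
  length at least \<open>k exp (k * \<alpha> k)\<close>. When \<open>r * x\<close> lies in that interval and \<open>k \<ge> r\<close>,
  \<open>g (r * x) - r * g x \<ge> (1 - r) * \<alpha> k \<ge> - k * \<alpha> k\<close>, so the integral of \<open>h x powr r / h (r * x)\<close>
  is at least \<open>k / r\<close> for every \<open>k \<ge> r\<close>.
\<close>

text \<open>The recursion is tuned so that \<open>intercept (Suc k) - intercept k\<close> equals
  \<open>slope k * y\<close> at the right end of the interval in
  \<open>envelope_eq_line\<close>.\<close>

fun intercept :: "nat \<Rightarrow> real" where
  "intercept 0 = 0"
| "intercept (Suc k) = 2 * (intercept k + exp (real k * intercept k))"

definition slope :: "nat \<Rightarrow> real" where
  "slope k = 2 * exp (- real k)"

definition line :: "nat \<Rightarrow> real \<Rightarrow> real" where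
  "line k x = intercept k + slope k * x"

definition envelope :: "real \<Rightarrow> real" where
  "envelope x = (INF k. line k x)"

lemma intercept_ge: "2 * real k \<le> intercept k"
proof (induction k)
  case (Suc k)
  define E where "E = exp (real k * intercept k)"
  have "1 \<le> E"
    using Suc by (simp add: E_def)
  with Suc show ?case by (simp flip: E_def)
qed simp

lemma intercept_nonneg: "0 \<le> intercept k"
  using intercept_ge[of k] by linarith

lemma intercept_mono: "j \<le> k \<Longrightarrow> intercept j \<le> intercept k"
proof (induction rule: dec_induct)
  case (step n)
  define E where "E = exp (real n * intercept n)"
  have "0 < E"
    by (simp add: E_def)
  with step show ?case
    using intercept_nonneg[of n] by (simp flip: E_def)
qed simp

lemma slope_pos: "0 < slope k"
  by (simp add: slope_def)

lemma slope_tendsto_0: "slope \<longlonglongrightarrow> 0"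
proof -
  have "(\<lambda>k. 2 * exp (- 1) ^ k) \<longlonglongrightarrow> 2 * (0::real)"
    by (intro tendsto_intros LIMSEQ_power_zero) simp
  moreover have "slope = (\<lambda>k. 2 * exp (- 1) ^ k)"
    by (simp add: slope_def fun_eq_iff flip: exp_of_nat_mult)
  ultimately show ?thesis by simp
qed

lemma line_nonneg: "0 \<le> x \<Longrightarrow> 0 \<le> line k x"
  using intercept_nonneg[of k] slope_pos[of k] by (simp add: line_def)

lemma bdd_below_lines: "0 \<le> x \<Longrightarrow> bdd_below (range (\<lambda>k. line k x))"
  using line_nonneg by (intro bdd_belowI[of _ 0]) auto

lemma envelope_le: "0 \<le> x \<Longrightarrow> envelope x \<le> line k x"
  unfolding envelope_def by (rule cINF_lower[OF bdd_below_lines]) auto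

lemma envelope_greatest: "(\<And>k. c \<le> line k x) \<Longrightarrow> c \<le> envelope x"
  unfolding envelope_def by (rule cINF_greatest) auto

lemma envelope_nonneg: "0 \<le> x \<Longrightarrow> 0 \<le> envelope x"
  by (intro envelope_greatest line_nonneg)

lemma concave_envelope: "convex_on {0<..} (\<lambda>x. - envelope x)"
proof (rule convex_onI)
  fix t x y :: real
  assume t: "0 < t" "t < 1" and xy: "x \<in> {0<..}" "y \<in> {0<..}"
  have "(1 - t) * envelope x + t * envelope y \<le> envelope ((1 - t) *\<^sub>R x + t *\<^sub>R y)"
  proof (rule envelope_greatest)
    fix k
    have "(1 - t) * envelope x + t * envelope y \<le> (1 - t) * line k x + t * line k y"
      using t xy by (intro add_mono mult_left_mono envelope_le) auto
    also have "\<dots> = line k ((1 - t) *\<^sub>R x + t *\<^sub>R y)"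
      by (simp add: line_def algebra_simps)
    finally show "(1 - t) * envelope x + t * envelope y \<le> line k ((1 - t) *\<^sub>R x + t *\<^sub>R y)" .
  qed
  then show "- envelope ((1 - t) *\<^sub>R x + t *\<^sub>R y) \<le> (1 - t) * - envelope x + t * - envelope y"
    by simp
qed simp

text \<open>A convex function on an open set is continuous; this supplies measurability for the
  integral comparisons.\<close>

lemma continuous_on_envelope: "continuous_on {0<..} envelope"
  using continuous_on_minus[OF convex_on_continuous[OF _ concave_envelope]] by simp

text \<open>Applying \<open>ln u \<le> u\<close> to u = x exp (-k) gives ln x \<le> k + exp (-k) x.
  Doubled, the right side has slope \<open>slope k\<close> and constant term 2 k \<le>
  \<open>intercept k\<close>.\<close>

lemma envelope_ge_ln:
  assumes "0 < x"
  shows "2 * ln x \<le> envelope x"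
proof (rule envelope_greatest)
  fix k
  have "ln (x * exp (- real k)) \<le> x * exp (- real k)"
    using assms ln_le_minus_one[of "x * exp (- real k)"] by simp
  then have "2 * ln x \<le> 2 * real k + 2 * exp (- real k) * x"
    using assms by (simp add: ln_mult algebra_simps)
  then show "2 * ln x \<le> line k x"
    using intercept_ge[of k] by (simp add: line_def slope_def)
qed

text \<open>A single line suffices for each e: its slope costs less than e / 2, and large n absorbs
  its intercept into the other e / 2.\<close>

lemma envelope_over_tendsto_0: "(\<lambda>n::nat. envelope (real n) / real n) \<longlonglongrightarrow> 0"
proof (rule LIMSEQ_I)
  fix e :: real
  assume e: "0 < e"
  then have "\<forall>\<^sub>F k in sequentially. slope k < e / 2"
    using order_tendstoD(2)[OF slope_tendsto_0, of "e / 2"] by simp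
  then obtain k where k: "slope k < e / 2"
    by (meson eventually_sequentially order_refl)
  obtain N :: nat where N: "2 * intercept k / e < real N"
    using reals_Archimedean2 by blast
  have "norm (envelope (real n) / real n - 0) < e" if "n \<ge> Suc N" for n
  proof -
    have n: "0 < real n" "2 * intercept k / e < real n"
      using that N by auto
    have "envelope (real n) \<le> line k (real n)"
      by (rule envelope_le) simp
    also have "\<dots> < e / 2 * real n + e / 2 * real n"
      unfolding line_def
    proof (rule add_strict_mono)
      show "intercept k < e / 2 * real n"
        using n e by (simp add: field_simps)
      show "slope k * real n < e / 2 * real n"
        using n k by simp
    qed
    finally show ?thesis
      using n envelope_nonneg[of "real n"] by (simp add: field_simps)
  qed
  then show "\<exists>N. \<forall>n\<ge>N. norm (envelope (real n) / real n - 0) < e"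
    by blast
qed

text \<open>The hypotheses amount to \<open>intercept k \<le> slope k * y\<close> and
  \<open>line k y \<le> intercept (Suc k)\<close>. The first beats lines of smaller index by slope,
  the second those of larger index by intercept.\<close>

lemma envelope_eq_line:
  assumes "intercept k * exp (real k) / 2 \<le> y"
    and "y \<le> (intercept k + 2 * exp (real k * intercept k)) * exp (real k) / 2"
  shows "envelope y = line k y"
proof (rule antisym)
  have y: "0 \<le> y"
    using assms(1) intercept_nonneg[of k] by (meson divide_nonneg_pos exp_ge_zero mult_nonneg_nonneg order_trans zero_less_numeral)
  then show "envelope y \<le> line k y"
    by (rule envelope_le)
  have lower: "intercept k \<le> slope k * y"
    using assms(1) by (simp add: slope_def exp_minus field_simps)
  have upper: "slope k * y \<le> intercept (Suc k) - intercept k"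
    using assms(2) by (simp add: slope_def exp_minus field_simps)
  show "line k y \<le> envelope y"
  proof (rule envelope_greatest)
    fix j
    consider "j < k" | "j = k" | "k < j" by linarith
    then show "line k y \<le> line j y"
    proof cases
      case 1
      \<comment> \<open>Slopes shrink by a factor exp 1 \<ge> 2 per index, so
        \<open>line j y\<close> \<ge> \<open>slope j * y\<close> \<ge>
        \<open>2 * slope k * y\<close> \<ge> \<open>line k y\<close>.\<close>
      have "2 \<le> exp (1::real)"
        using exp_ge_add_one_self[of 1] by simp
      then have "2 * slope k \<le> exp 1 * slope k"
        using slope_pos[of k] by (intro mult_right_mono) auto
      also have "\<dots> = 2 * exp (1 - real k)"
        by (simp add: slope_def flip: exp_add)
      also have "\<dots> \<le> slope j"
        using 1 by (simp add: slope_def)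
      finally have "2 * slope k * y \<le> slope j * y"
        using y by (intro mult_right_mono)
      then show ?thesis
        using lower intercept_nonneg[of j] by (simp add: line_def)
    next
      case 3
      then have "intercept (Suc k) \<le> intercept j"
        by (intro intercept_mono) simp
      moreover have "0 \<le> slope j * y"
        using y slope_pos[of j] by simp
      ultimately show ?thesis
        using upper by (simp add: line_def)
    qed simp
  qed
qed

lemma set_integrable_exp_envelope: "set_integrable lebesgue {0<..} (\<lambda>x. exp (- envelope x))"
proof -
  have cont: "continuous_on {0<..} (\<lambda>x. exp (- envelope x))"
    by (intro continuous_intros continuous_on_envelope)
  have meas: "(\<lambda>x. exp (- envelope x)) \<in> borel_measurable (lebesgue_on S)"
    if "S \<subseteq> {0<..}" "S \<in> sets lebesgue" for S
    using that by (intro continuous_imp_measurable_on_sets_lebesgue continuous_on_subset[OF cont])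
  \<comment> \<open>The split at 1 is needed because 1 / x^2 is not integrable near 0; there the
    bound 1 is used.\<close>
  have near: "(\<lambda>x. exp (- envelope x)) absolutely_integrable_on {0<..1}"
  proof (rule measurable_bounded_by_integrable_imp_absolutely_integrable)
    show "(\<lambda>x::real. 1::real) integrable_on {0<..1}"
      by (intro integrable_on_const bounded_set_imp_lmeasurable) auto
  qed (auto intro!: meas envelope_nonneg)
  have far: "(\<lambda>x. exp (- envelope x)) absolutely_integrable_on {1..}"
  proof (rule measurable_bounded_by_integrable_imp_absolutely_integrable)
    show "(\<lambda>x::real. 1 / x ^ 2) integrable_on {1..}"
      using has_integral_inverse_power_to_inf[of 2 1] by (auto simp: integrable_on_def)
    fix x :: real
    assume x: "x \<in> {1..}"
    then have "exp (- envelope x) \<le> exp (- (2 * ln x))"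
      using envelope_ge_ln[of x] by simp
    also have "\<dots> = 1 / x ^ 2"
      using x by (simp add: exp_minus exp_double inverse_eq_divide)
    finally show "norm (exp (- envelope x)) \<le> 1 / x ^ 2"
      by simp
  qed (auto intro!: meas)
  have "{0<..} = {0<..1} \<union> {1::real..}"
    by auto
  then show ?thesis
    using absolutely_integrable_Un[OF near far] by simp
qed

lemma exp_envelope_ratio_not_integrable:
  assumes r: "0 < r"
  shows "\<not> set_integrable lebesgue {0<..}
           (\<lambda>x. exp (- envelope x) powr r / exp (- envelope (r * x)))"
    (is "\<not> set_integrable _ _ ?f")
proof
  assume int: "set_integrable lebesgue {0<..} ?f"
  define I where "I = (LINT x:{0<..}|lebesgue. ?f x)"
  have bound: "real k / r \<le> I" if k: "r \<le> real k" for k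
  proof -
    define E where "E = exp (real k * intercept k)"
    \<comment> \<open>\<open>a\<close> and \<open>b\<close> are the endpoints from
      \<open>envelope_eq_line\<close> divided by \<open>r\<close>, so that \<open>r * x\<close> runs
      through that interval.\<close>
    define a where "a = intercept k * exp (real k) / (2 * r)"
    define b where "b = (intercept k + 2 * E) * exp (real k) / (2 * r)"
    have k0: "0 < real k"
      using k r by linarith
    then have "0 < intercept k"
      using intercept_ge[of k] by linarith
    then have a0: "0 < a"
      using r by (simp add: a_def)
    have E0: "0 < E"
      by (simp add: E_def)
    have len: "b - a = E * exp (real k) / r"
      using r by (simp add: a_def b_def field_simps)
    have ab: "a \<le> b"
      using len E0 r by (smt (verit) divide_pos_pos exp_gt_zero mult_pos_pos)
    have ratio: "1 / E \<le> ?f x" if x: "x \<in> {a..b}" for x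
    proof -
      have x0: "0 \<le> x"
        using x a0 by simp
      have "envelope (r * x) = line k (r * x)"
        using x r by (intro envelope_eq_line) (auto simp: a_def b_def E_def field_simps)
      moreover have "r * envelope x \<le> r * line k x"
        using r x0 by (intro mult_left_mono envelope_le) auto
      moreover have "r * intercept k \<le> real k * intercept k"
        using k intercept_nonneg by (intro mult_right_mono)
      \<comment> \<open>The slope terms cancel in \<open>line k (r * x) - r * line k x\<close>,
        leaving (1 - r) times \<open>intercept k\<close>.\<close>
      ultimately have "- (real k * intercept k) \<le> envelope (r * x) - r * envelope x"
        using intercept_nonneg[of k] by (simp add: line_def algebra_simps)
      then have "exp (- (real k * intercept k)) \<le> exp (envelope (r * x) - r * envelope x)"
        by simp
      also have "\<dots> = ?f x"
        by (simp add: powr_def exp_diff exp_minus ln_div field_simps)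
      finally show ?thesis
        by (simp add: E_def exp_minus field_simps)
    qed
    \<comment> \<open>The factor \<open>E\<close> in the length of the interval cancels the lower
      bound \<open>1 / E\<close> of the integrand, leaving exp k / r.\<close>
    have "real k / r \<le> exp (real k) / r"
      using r exp_ge_add_one_self[of "real k"] by (intro divide_right_mono) linarith+
    also have "\<dots> = (b - a) * (1 / E)"
      using E0 by (simp add: len)
    also have "\<dots> = (LINT x:{a..b}|lebesgue. 1 / E)"
      using ab by (simp add: set_lebesgue_integral_def)
    also have "\<dots> \<le> I"
      unfolding I_def set_lebesgue_integral_def
    proof (rule integral_mono)
      show "integrable lebesgue (\<lambda>x. indicat_real {a..b} x *\<^sub>R (1 / E))"
        by (intro integrable_scaleR_left integrable_real_indicator) (auto simp: emeasure_lborel_Icc_eq)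
      show "integrable lebesgue (\<lambda>x. indicat_real {0<..} x *\<^sub>R ?f x)"
        using int by (simp add: set_integrable_def)
      show "indicat_real {a..b} x *\<^sub>R (1 / E) \<le> indicat_real {0<..} x *\<^sub>R ?f x" for x
        using ratio[of x] a0 by (auto simp: indicator_def)
    qed
    finally show ?thesis .
  qed
  \<comment> \<open>Such a k satisfies the hypothesis of \<open>bound\<close> and also has k / r >
    \<open>I\<close>.\<close>
  obtain k :: nat where k: "max r (I * r) < real k"
    using reals_Archimedean2 by blast
  then show False
    using bound[of k] r by (simp add: field_simps)
qed

theorem theorem1:
  shows "\<exists>h :: real \<Rightarrow> real.
    h \<in> {0<..} \<rightarrow> {0<..} \<and>
    log_convex h \<and>
    set_integrable lebesgue {0<..} h \<and>
    ((\<lambda>n::nat. h (real n) powr (1 / real n)) \<longlonglongrightarrow> 1) \<and>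
    (\<forall>r::real. r > 0 \<longrightarrow>
       \<not> set_integrable lebesgue {0<..} (\<lambda>x. h x powr r / h (r * x)))"
proof (intro exI conjI allI impI)
  let ?h = "\<lambda>x. exp (- envelope x)"
  show "?h \<in> {0<..} \<rightarrow> {0<..}"
    by simp
  show "log_convex ?h"
    using concave_envelope by (simp add: log_convex_def)
  show "set_integrable lebesgue {0<..} ?h"
    by (rule set_integrable_exp_envelope)
  \<comment> \<open>This sequence agrees with the required one also at n = 0, where division by zero
    gives 0 and both terms are 1.\<close>
  have "(\<lambda>n. exp (- (envelope (real n) / real n))) \<longlonglongrightarrow> exp (- 0)"
    by (intro tendsto_intros envelope_over_tendsto_0)
  then show "(\<lambda>n::nat. ?h (real n) powr (1 / real n)) \<longlonglongrightarrow> 1"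
    by (simp add: powr_def)
  show "\<not> set_integrable lebesgue {0<..} (\<lambda>x. ?h x powr r / ?h (r * x))" if "r > 0" for r
    using that by (rule exp_envelope_ratio_not_integrable)
qed

end
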